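(* There is an absolute constant $C>0$ and an algorithm which, given as input a positive integer $n$, an integer $k$ with $1\le k<n$, and the real numbers $e_1(\boldsymbol\mu),\dots,e_k(\boldsymbol\mu)$ for some unknown vector $\boldsymbol\mu=(\mu_1,\dots,\mu_n)\in\mathbb{R}_{\ge 0}^n$, outputs a number $\mu^*_{\max}$ satisfying \[ \mu^*_{\max}\le \mu_{\max}\le \alpha_{k,n}\,\mu^*_{\max},\qquad \text{where}\quad \alpha_{k,n}=\begin{cases} n^{1/k} & k\le \log n,\\ 1+C\left(\frac{\log n}{k}\right)^2 & k>\log n,\end{cases}\] and $\mu_{\max}=\max_i\mu_i$. Moreover, the algorithm runs in time polynomial in $k$.
   Context: For $\boldsymbol\mu\in\mathbb{R}^n$ and $1\le i\le n$, $e_i(\boldsymbol\mu)=\sum_{T\subseteq[n],\,|T|=i}\prod_{j\in T}\mu_j$ is the $i$-th elementary symmetric polynomial of the coordinates. Equivalently, if $\prod_{j=1}^n(x-\mu_j)=x^n+c_1x^{n-1}+\dots+c_n$, then $c_i=(-1)^ie_i(\boldsymbol\mu)$, so the input is the same as the top $k$ coefficients of the monic polynomial with roots $\mu_1,\dots,\mu_n$. *)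

theory Defs
  imports Complex_Main "HOL-Computational_Algebra.Polynomial"
begin

definition esym :: "nat \<Rightarrow> (nat \<Rightarrow> real) \<Rightarrow> nat \<Rightarrow> real" where
  "esym n \<mu> i = (\<Sum>T | T \<subseteq> {1..n} \<and> card T = i. \<Prod>j\<in>T. \<mu> j)"

definition mu_max :: "nat \<Rightarrow> (nat \<Rightarrow> real) \<Rightarrow> real" where
  "mu_max n \<mu> = Max (\<mu> ` {1..n})"

definition alpha :: "real \<Rightarrow> nat \<Rightarrow> nat \<Rightarrow> real" where
  "alpha C k n =
     (if real k \<le> ln (real n) then real n powr (1 / real k)
      else 1 + C * (ln (real n) / real k)\<^sup>2)"

text \<open>
  The model of computation is a uniform real RAM, presented as a while language. A state consists
  of natural-number registers, used for counting and for addressing, and of arrays of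
  exact reals. Available are addition and truncated subtraction of naturals, the conversion of a
  natural to a real, the four field operations on reals (with \<open>x / 0 = 0\<close>), indirect addressing,
  and exact comparisons, each at unit cost. There is no rounding operation, no conversion
  from reals to naturals, and the only constants in programs are natural numbers.
\<close>

type_synonym vname = string
type_synonym state = "(vname \<Rightarrow> nat) \<times> (vname \<Rightarrow> nat \<Rightarrow> real)"

datatype iexp = IConst nat | IVar vname | IAdd iexp iexp | ISub iexp iexp

datatype rexp = OfNat iexp | Cell vname iexp
  | RAdd rexp rexp | RSub rexp rexp | RMul rexp rexp | RDiv rexp rexp

datatype bexp = ILess iexp iexp | RLess rexp rexp | BNot bexp | BAnd bexp bexp

datatype com = SKIP
  | IAssign vname iexp
  | RAssign vname iexp rexp
  | Seq com com
  | IfC bexp com com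
  | While bexp com

fun ival :: "iexp \<Rightarrow> state \<Rightarrow> nat" where
  "ival (IConst m) s = m"
| "ival (IVar x) s = fst s x"
| "ival (IAdd a b) s = ival a s + ival b s"
| "ival (ISub a b) s = ival a s - ival b s"

fun rval :: "rexp \<Rightarrow> state \<Rightarrow> real" where
  "rval (OfNat a) s = real (ival a s)"
| "rval (Cell A a) s = snd s A (ival a s)"
| "rval (RAdd p q) s = rval p s + rval q s"
| "rval (RSub p q) s = rval p s - rval q s"
| "rval (RMul p q) s = rval p s * rval q s"
| "rval (RDiv p q) s = rval p s / rval q s"

fun bval :: "bexp \<Rightarrow> state \<Rightarrow> bool" where
  "bval (ILess a b) s \<longleftrightarrow> ival a s < ival b s"
| "bval (RLess p q) s \<longleftrightarrow> rval p s < rval q s"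
| "bval (BNot b) s \<longleftrightarrow> \<not> bval b s"
| "bval (BAnd b c) s \<longleftrightarrow> bval b s \<and> bval c s"

fun icost :: "iexp \<Rightarrow> nat" where
  "icost (IConst m) = 1"
| "icost (IVar x) = 1"
| "icost (IAdd a b) = 1 + icost a + icost b"
| "icost (ISub a b) = 1 + icost a + icost b"

fun rcost :: "rexp \<Rightarrow> nat" where
  "rcost (OfNat a) = 1 + icost a"
| "rcost (Cell A a) = 1 + icost a"
| "rcost (RAdd p q) = 1 + rcost p + rcost q"
| "rcost (RSub p q) = 1 + rcost p + rcost q"
| "rcost (RMul p q) = 1 + rcost p + rcost q"
| "rcost (RDiv p q) = 1 + rcost p + rcost q"

fun bcost :: "bexp \<Rightarrow> nat" where
  "bcost (ILess a b) = 1 + icost a + icost b"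
| "bcost (RLess p q) = 1 + rcost p + rcost q"
| "bcost (BNot b) = 1 + bcost b"
| "bcost (BAnd b c) = 1 + bcost b + bcost c"

text \<open>\<open>exec c s t s'\<close>: started in \<open>s\<close>, the program \<open>c\<close> halts in state \<open>s'\<close> after \<open>t\<close> time units.\<close>

inductive exec :: "com \<Rightarrow> state \<Rightarrow> nat \<Rightarrow> state \<Rightarrow> bool" where
  Skip: "exec SKIP s 1 s"
| IAssign: "exec (IAssign x a) s (1 + icost a) ((fst s)(x := ival a s), snd s)"
| RAssign: "exec (RAssign A a p) s (1 + icost a + rcost p)
      (fst s, (snd s)(A := (snd s A)(ival a s := rval p s)))"
| Seq: "exec c s t s' \<Longrightarrow> exec d s' t' s'' \<Longrightarrow> exec (Seq c d) s (t + t') s''"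
| IfTrue: "bval b s \<Longrightarrow> exec c s t s' \<Longrightarrow> exec (IfC b c d) s (1 + bcost b + t) s'"
| IfFalse: "\<not> bval b s \<Longrightarrow> exec d s t s' \<Longrightarrow> exec (IfC b c d) s (1 + bcost b + t) s'"
| WhileFalse: "\<not> bval b s \<Longrightarrow> exec (While b c) s (1 + bcost b) s"
| WhileTrue: "bval b s \<Longrightarrow> exec c s t s' \<Longrightarrow> exec (While b c) s' t' s'' \<Longrightarrow>
      exec (While b c) s (1 + bcost b + t + t') s''"

text \<open>Hence the output and the running time are functions of the program and the input.\<close>

lemma exec_deterministic:
  "exec c s t s' \<Longrightarrow> exec c s u r \<Longrightarrow> u = t \<and> r = s'"
proof (induction arbitrary: u r rule: exec.induct)
  case (Skip s)
  from Skip.prems show ?case by cases simp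
next
  case (IAssign x a s)
  from IAssign.prems show ?case by cases simp
next
  case (RAssign A a p s)
  from RAssign.prems show ?case by cases simp
next
  case (Seq c s t s' d t' s'')
  note IH = Seq.IH
  from Seq.prems show ?case
  proof cases
    case (Seq v w v')
    from IH(1)[OF \<open>exec c s v w\<close>] have "v = t" "w = s'" by simp_all
    with Seq IH(2)[of v' r] show ?thesis by simp
  qed
next
  case (IfTrue b s c t s' d)
  from IfTrue.prems show ?case by cases (use IfTrue.hyps in \<open>auto dest: IfTrue.IH\<close>)
next
  case (IfFalse b s d t s' c)
  from IfFalse.prems show ?case by cases (use IfFalse.hyps in \<open>auto dest: IfFalse.IH\<close>)
next
  case (WhileFalse b s c)
  from WhileFalse.prems show ?case by cases (use WhileFalse.hyps in simp_all)
next
  case (WhileTrue b s c t s' t' s'')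
  note hyps = WhileTrue.hyps and IH = WhileTrue.IH
  from WhileTrue.prems show ?case
  proof cases
    case WhileFalse
    with hyps show ?thesis by simp
  next
    case (WhileTrue v w v')
    from IH(1)[OF \<open>exec c s v w\<close>] have "v = t" "w = s'" by simp_all
    with WhileTrue IH(2)[of v' r] show ?thesis by simp
  qed
qed

text \<open>
  The input consists of \<open>n\<close>, \<open>k\<close> and \<open>a 1, \<dots>, a k\<close>; everything else is initialised to \<open>0\<close>, so that
  values \<open>a i\<close> with \<open>i > k\<close> are not visible to the program.
\<close>

definition input_state :: "nat \<Rightarrow> nat \<Rightarrow> (nat \<Rightarrow> real) \<Rightarrow> state" where
  "input_state n k a =
     ((\<lambda>_. 0)(''n'' := n, ''k'' := k),
      (\<lambda>_ _. 0)(''e'' := (\<lambda>i. if i \<in> {1..k} then a i else 0)))"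

definition result :: "state \<Rightarrow> real" where
  "result s = snd s ''out'' 0"

end

theory Submission
  imports Defs "HOL-Computational_Algebra.Formal_Power_Series"
begin

text \<open>
  Newton's identities turn the input into the power sums \<open>p\<^sub>0, \<dots>, p\<^sub>k\<close> of \<open>\<mu>\<close>. Since the machine
  cannot extract roots, the usual estimate \<open>(p\<^sub>k / n)\<^bsup>1/k\<^esup>\<close> is replaced by \<open>m = p\<^sub>k / p\<^bsub>k-1\<^esub>\<close>, which
  satisfies the same bounds \<open>m \<le> \<mu>\<^sub>m\<^sub>a\<^sub>x \<le> n\<^bsup>1/k\<^esup> m\<close>. For \<open>k > ln n\<close> this is exact up to the factor \<open>e < 3\<close>,
  so it suffices to scan the \<open>2 k\<^sup>2\<close> points \<open>t = m + j m / k\<^sup>2\<close> up to \<open>3 m\<close>. With the Chebyshev polynomial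
  \<open>T\<^sub>k\<close>, put \<open>S = \<Sum>i. T\<^sub>k (\<mu> i / t)\<close>. As \<open>\<bar>T\<^sub>k\<bar> \<le> 1\<close> on \<open>[0, 1]\<close>, \<open>S > n\<close> certifies \<open>t < \<mu>\<^sub>m\<^sub>a\<^sub>x\<close>; conversely, if
  \<open>S \<le> n\<close> then \<open>T\<^sub>k (\<mu>\<^sub>m\<^sub>a\<^sub>x / t) \<le> 2 n\<close>, and the growth \<open>T\<^sub>k (cosh u) = cosh (k u)\<close> forces
  \<open>\<mu>\<^sub>m\<^sub>a\<^sub>x / t \<le> 1 + O((ln n / k)\<^sup>2)\<close>. The output, the last certified \<open>t\<close> (or \<open>m\<close>), serves both regimes, so the
  program never has to compare \<open>k\<close> with \<open>ln n\<close>.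
\<close>

subsection \<open>Newton's identities\<close>

text \<open>This generalises \<open>esym\<close> to an arbitrary index set, so that Newton's
  identities can be proved by adding one index at a time.\<close>

definition sympoly :: "'a set \<Rightarrow> ('a \<Rightarrow> real) \<Rightarrow> nat \<Rightarrow> real" where
  "sympoly S \<mu> m = (\<Sum>T | T \<subseteq> S \<and> card T = m. \<Prod>j\<in>T. \<mu> j)"

lemma sympoly_0: "finite S \<Longrightarrow> sympoly S \<mu> 0 = 1"
proof -
  assume "finite S"
  then have "{T. T \<subseteq> S \<and> card T = 0} = {{}}"
    by (auto dest: finite_subset)
  then show ?thesis by (simp add: sympoly_def)
qed

text \<open>The subsets of \<open>insert x S\<close> split into those avoiding \<open>x\<close> and
  those containing it. Read on generating functions, this multiplies by
  \<open>1 + \<mu> x * X\<close>.\<close>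

lemma sympoly_insert:
  assumes "finite S" "x \<notin> S"
  shows "sympoly (insert x S) \<mu> (Suc m) = sympoly S \<mu> (Suc m) + \<mu> x * sympoly S \<mu> m"
proof -
  let ?P = "\<lambda>m. {T. T \<subseteq> S \<and> card T = m}"
  have split: "{T. T \<subseteq> insert x S \<and> card T = Suc m} = ?P (Suc m) \<union> insert x ` ?P m"
  proof (intro equalityI subsetI)
    fix T assume T: "T \<in> {T. T \<subseteq> insert x S \<and> card T = Suc m}"
    show "T \<in> ?P (Suc m) \<union> insert x ` ?P m"
    proof (cases "x \<in> T")
      case True
      then have "T = insert x (T - {x})" by auto
      moreover have "T - {x} \<in> ?P m" using T True by (auto simp: card_Diff_singleton)
      ultimately show ?thesis by blast
    qed (use T in auto)
  next
    fix T assume "T \<in> ?P (Suc m) \<union> insert x ` ?P m"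
    moreover have "finite U" "x \<notin> U" if "U \<subseteq> S" for U
      using that assms by (auto dest: finite_subset)
    ultimately show "T \<in> {T. T \<subseteq> insert x S \<and> card T = Suc m}"
      by auto
  qed
  have inj: "inj_on (insert x) (?P m)"
    using assms(2) by (auto simp: inj_on_def)
  have "sympoly (insert x S) \<mu> (Suc m) = sympoly S \<mu> (Suc m) + (\<Sum>T\<in>insert x ` ?P m. \<Prod>j\<in>T. \<mu> j)"
    unfolding sympoly_def split using assms by (subst sum.union_disjoint) auto
  also have "(\<Sum>T\<in>insert x ` ?P m. \<Prod>j\<in>T. \<mu> j) = (\<Sum>T\<in>?P m. \<mu> x * (\<Prod>j\<in>T. \<mu> j))"
    unfolding sum.reindex[OF inj] o_def
  proof (rule sum.cong[OF refl])
    fix T assume "T \<in> ?P m"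
    then have "finite T" "x \<notin> T" using assms by (auto dest: finite_subset)
    then show "prod \<mu> (insert x T) = \<mu> x * prod \<mu> T" by simp
  qed
  finally show ?thesis by (simp add: sympoly_def sum_distrib_left)
qed

text \<open>Coefficientwise form of \<open>F' = G F\<close> for \<open>F = \<Prod>j. (1 + \<mu> j X)\<close>, where \<open>G\<close> is the logarithmic derivative.\<close>

lemma newton_identity:
  assumes "finite S"
  shows "real (Suc m) * sympoly S \<mu> (Suc m) =
    - (\<Sum>i=0..m. (\<Sum>j\<in>S. (- \<mu> j) ^ Suc i) * sympoly S \<mu> (m - i))"
proof -
  define F where "F S = Abs_fps (sympoly S \<mu>)" for S
  define G where "G S = Abs_fps (\<lambda>i. - (\<Sum>j\<in>S. (- \<mu> j) ^ Suc i))" for S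
  have "fps_deriv (F S) = G S * F S"
    using assms
  proof (induction S rule: finite_induct)
    case empty
    have "sympoly {} \<mu> (Suc i) = 0" for i
    proof -
      have "{T. T \<subseteq> {} \<and> card T = Suc i} = ({} :: 'a set set)" by auto
      then show ?thesis by (simp add: sympoly_def)
    qed
    then show ?case by (simp add: fps_eq_iff F_def G_def fps_mult_nth)
  next
    case (insert x S)
    \<comment> \<open>\<open>L\<close> is the new linear factor and \<open>H\<close> its logarithmic
      derivative, the geometric series of \<open>\<mu> x / (1 + \<mu> x * X)\<close>. The identity
      \<open>L * H = \<mu> x\<close> is then what turns the product rule into the claim for
      \<open>insert x S\<close>.\<close>
    define L where "L = 1 + fps_const (\<mu> x) * fps_X"
    define H where "H = Abs_fps (\<lambda>i. - ((- \<mu> x) ^ Suc i))"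
    have FI: "F (insert x S) = L * F S"
    proof (rule fps_ext)
      fix i
      show "fps_nth (F (insert x S)) i = fps_nth (L * F S) i"
        using insert.hyps
        by (cases i) (simp_all add: F_def L_def sympoly_0 sympoly_insert distrib_right mult.assoc)
    qed
    have GI: "G (insert x S) = G S + H"
      using insert.hyps by (auto simp: fps_eq_iff G_def H_def)
    have HL: "L * H = fps_const (\<mu> x)"
    proof (rule fps_ext)
      fix i
      show "fps_nth (L * H) i = fps_nth (fps_const (\<mu> x)) i"
        by (cases i) (simp_all add: H_def L_def distrib_right mult.assoc)
    qed
    have "fps_deriv (F (insert x S)) = fps_const (\<mu> x) * F S + L * (G S * F S)"
      by (simp add: FI insert.IH) (simp add: L_def)
    also have "\<dots> = (G S + H) * (L * F S)"
      by (simp add: HL[symmetric] algebra_simps)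
    finally show ?case by (simp add: FI GI)
  qed
  then have "fps_nth (fps_deriv (F S)) m = fps_nth (G S * F S) m" by simp
  then show ?thesis
    by (simp add: F_def G_def fps_mult_nth sum_negf)
qed

definition signed_power_sum :: "nat \<Rightarrow> (nat \<Rightarrow> real) \<Rightarrow> nat \<Rightarrow> real" where
  "signed_power_sum n \<mu> a = (\<Sum>i=1..n. (- \<mu> i) ^ a)"

text \<open>Newton's identity solved for its top term, in the order in which
  \<open>newton_prog\<close> evaluates it. The term \<open>i = m\<close> is split off because
  \<open>e_0 = 1\<close> is not stored in the input array; \<open>0 -\<close> stands for negation,
  which the machine does not offer.\<close>

lemma signed_power_sum_rec:
  assumes "1 \<le> m"
  shows "signed_power_sum n \<mu> m =
    0 - real m * esym n \<mu> m - (\<Sum>i=1..<m. signed_power_sum n \<mu> i * esym n \<mu> (m - i))"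
proof -
  obtain l where m: "m = Suc l" using assms by (cases m) auto
  have e: "esym n \<mu> = sympoly {1..n} \<mu>"
    by (simp add: fun_eq_iff esym_def sympoly_def)
  have "real m * esym n \<mu> m =
      - (\<Sum>i=0..l. signed_power_sum n \<mu> (Suc i) * esym n \<mu> (l - i))"
    unfolding e m signed_power_sum_def by (rule newton_identity) simp
  also have "(\<Sum>i=0..l. signed_power_sum n \<mu> (Suc i) * esym n \<mu> (l - i)) =
      (\<Sum>i=1..m. signed_power_sum n \<mu> i * esym n \<mu> (m - i))"
    unfolding m by (simp add: sum.shift_bounds_cl_Suc_ivl del: sum.cl_ivl_Suc)
  also have "{1..m} = insert m {1..<m}" using assms by auto
  finally show ?thesis by (simp add: e sympoly_0)
qed

lemma signed_power_sum_eq: "signed_power_sum n \<mu> a = (-1) ^ a * (\<Sum>i=1..n. \<mu> i ^ a)"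
  by (simp add: signed_power_sum_def power_minus[of "\<mu> _"] sum_distrib_left)

subsection \<open>The quotient of consecutive power sums\<close>

lemma mu_max_ge: "i \<in> {1..n} \<Longrightarrow> \<mu> i \<le> mu_max n \<mu>"
  by (simp add: mu_max_def)

lemma mu_max_attained:
  assumes "1 \<le> n"
  obtains i where "i \<in> {1..n}" "mu_max n \<mu> = \<mu> i"
proof -
  have "mu_max n \<mu> \<in> \<mu> ` {1..n}"
    unfolding mu_max_def using assms by (intro Max_in) auto
  then show ?thesis using that by blast
qed

text \<open>Consecutive signed power sums differ by one sign, which the leading \<open>0 -\<close>
  undoes. If all \<mu> i vanish and \<open>k > 1\<close>, the quotient is \<open>0 / 0 = 0\<close>,
  which is the correct answer.\<close>

definition ratio_estimate :: "nat \<Rightarrow> nat \<Rightarrow> (nat \<Rightarrow> real) \<Rightarrow> real" where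
  "ratio_estimate n k \<mu> = 0 - signed_power_sum n \<mu> k / signed_power_sum n \<mu> (k - 1)"

lemma ratio_estimate_eq:
  assumes "1 \<le> k"
  shows "ratio_estimate n k \<mu> = (\<Sum>i=1..n. \<mu> i ^ k) / (\<Sum>i=1..n. \<mu> i ^ (k - 1))"
proof -
  obtain l where "k = Suc l" using assms by (cases k) auto
  then show ?thesis
    by (simp add: ratio_estimate_def signed_power_sum_eq mult_divide_mult_cancel_left)
qed

lemma ratio_estimate_nonneg:
  assumes "1 \<le> k" "\<And>i. i \<in> {1..n} \<Longrightarrow> 0 \<le> \<mu> i"
  shows "0 \<le> ratio_estimate n k \<mu>"
  unfolding ratio_estimate_eq[OF assms(1)]
  using assms(2) by (intro divide_nonneg_nonneg sum_nonneg) auto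

lemma ratio_estimate_le:
  assumes "1 \<le> k" "1 \<le> n" and nn: "\<And>i. i \<in> {1..n} \<Longrightarrow> 0 \<le> \<mu> i"
  shows "ratio_estimate n k \<mu> \<le> mu_max n \<mu>"
proof -
  obtain l where k: "k = Suc l" using assms(1) by (cases k) auto
  have M: "0 \<le> mu_max n \<mu>"
    using nn assms(2) mu_max_attained by metis
  have "(\<Sum>i=1..n. \<mu> i ^ k) \<le> (\<Sum>i=1..n. mu_max n \<mu> * \<mu> i ^ l)"
    unfolding k power_Suc by (intro sum_mono mult_right_mono mu_max_ge zero_le_power nn) auto
  then have *: "(\<Sum>i=1..n. \<mu> i ^ k) \<le> mu_max n \<mu> * (\<Sum>i=1..n. \<mu> i ^ (k - 1))"
    by (simp add: k sum_distrib_left)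
  have "0 \<le> (\<Sum>i=1..n. \<mu> i ^ (k - 1))" by (intro sum_nonneg zero_le_power nn)
  with * M show ?thesis
    unfolding ratio_estimate_eq[OF assms(1)]
    by (cases "(\<Sum>i=1..n. \<mu> i ^ (k - 1)) = 0") (auto simp: divide_le_eq)
qed

text \<open>Young's inequality for the exponents \<open>l\<close> and \<open>1\<close>: Bernoulli's
  inequality at \<open>s / x\<close>, multiplied by \<open>x ^ Suc l\<close>.\<close>

lemma young_power:
  fixes x s :: real
  assumes "0 \<le> x" "0 \<le> s"
  shows "real (Suc l) * (x ^ l * s) \<le> real l * x ^ Suc l + s ^ Suc l"
proof (cases "x = 0")
  case True
  then show ?thesis using assms by (cases l) auto
next
  case False
  with assms have x: "0 < x" by simp
  have "1 + real (Suc l) * (s / x - 1) \<le> (1 + (s / x - 1)) ^ Suc l"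
    using assms x by (intro Bernoulli_inequality) simp
  then have "(1 + real (Suc l) * (s / x - 1)) * x ^ Suc l \<le> (s / x) ^ Suc l * x ^ Suc l"
    using x by (intro mult_right_mono) auto
  also have "(s / x) ^ Suc l * x ^ Suc l = s ^ Suc l"
    using x by (simp add: power_divide)
  also have "(1 + real (Suc l) * (s / x - 1)) * x ^ Suc l =
      real (Suc l) * (x ^ l * s) - real l * x ^ Suc l"
    using x by (simp add: field_simps)
  finally show ?thesis by simp
qed

text \<open>Let \<open>s\<close> be the maximum divided by the \<open>k\<close>-th root of
  \<open>n\<close>, so that \<open>n * s ^ k\<close> is the \<open>k\<close>-th power of the maximum
  and hence at most \<open>p_k\<close>. Summing \<open>young_power\<close> over all \<mu> i gives
  \<open>k * p_(k-1) * s \<le> (k-1) * p_k + n * s ^ k \<le> k * p_k\<close>.\<close>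

lemma mu_max_le_ratio_estimate:
  assumes "1 \<le> k" "1 \<le> n" and nn: "\<And>i. i \<in> {1..n} \<Longrightarrow> 0 \<le> \<mu> i"
  shows "mu_max n \<mu> \<le> real n powr (1 / real k) * ratio_estimate n k \<mu>"
proof -
  obtain l where k: "k = Suc l" using assms(1) by (cases k) auto
  obtain i0 where i0: "i0 \<in> {1..n}" "mu_max n \<mu> = \<mu> i0"
    using mu_max_attained assms(2) by blast
  let ?p = "\<lambda>a. \<Sum>i=1..n. \<mu> i ^ a"
  let ?r = "real n powr (1 / real k)"
  have r: "0 < ?r" "?r ^ k = real n"
    using assms by (auto simp: powr_realpow[symmetric] powr_powr)
  define s where "s = mu_max n \<mu> / ?r"
  have s: "0 \<le> s" using i0 nn r by (simp add: s_def)
  have max_le: "mu_max n \<mu> ^ a \<le> ?p a" for a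
    unfolding i0(2) using i0(1) nn by (intro member_le_sum) auto
  have "real n * s ^ k \<le> ?p k"
    using max_le[of k] r assms by (simp add: s_def power_divide)
  moreover have "real k * (?p l * s) \<le> real l * ?p k + real n * s ^ k"
  proof -
    have "(\<Sum>i=1..n. real k * (\<mu> i ^ l * s)) \<le> (\<Sum>i=1..n. real l * \<mu> i ^ k + s ^ k)"
      unfolding k using nn s by (intro sum_mono young_power) auto
    then show ?thesis
      by (simp add: sum.distrib sum_distrib_left sum_distrib_right mult_ac)
  qed
  ultimately have "real k * (?p l * s) \<le> real k * ?p k"
    by (simp add: k algebra_simps)
  then have *: "?p l * s \<le> ?p k" using assms(1) by simp
  show ?thesis
  proof (cases "?p l = 0")
    case True
    with max_le[of l] i0 nn[OF i0(1)] have "mu_max n \<mu> = 0"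
      by (metis dual_order.antisym power_eq_0_iff zero_le_power)
    then show ?thesis using r ratio_estimate_nonneg[OF assms(1) nn] by simp
  next
    case False
    moreover have "0 \<le> ?p l" by (intro sum_nonneg zero_le_power nn)
    ultimately have "s \<le> ratio_estimate n k \<mu>"
      using * unfolding ratio_estimate_eq[OF assms(1)] by (simp add: k pos_le_divide_eq mult.commute)
    then show ?thesis using r by (simp add: s_def divide_le_eq mult.commute)
  qed
qed

subsection \<open>Chebyshev certificates\<close>

fun cheb :: "nat \<Rightarrow> real \<Rightarrow> real" where
  "cheb 0 x = 1"
| "cheb (Suc 0) x = x"
| "cheb (Suc (Suc j)) x = 2 * x * cheb (Suc j) x - cheb j x"

lemma cheb_cos: "cheb j (cos \<theta>) = cos (real j * \<theta>)"
proof (induction j "cos \<theta>" rule: cheb.induct)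
  case (3 j)
  have "cos (real (Suc (Suc j)) * \<theta>) + cos (real j * \<theta>) = 2 * cos \<theta> * cos (real (Suc j) * \<theta>)"
    using cos_add[of "real (Suc j) * \<theta>" \<theta>] cos_diff[of "real (Suc j) * \<theta>" \<theta>]
    by (simp add: algebra_simps)
  with 3 show ?case by simp
qed auto

lemma cheb_cosh: "cheb j (cosh u) = cosh (real j * u)"
proof (induction j "cosh u" rule: cheb.induct)
  case (3 j)
  have "cosh (real (Suc (Suc j)) * u) + cosh (real j * u) = 2 * cosh u * cosh (real (Suc j) * u)"
    using cosh_add[of "real (Suc j) * u" u] cosh_diff[of "real (Suc j) * u" u]
    by (simp add: algebra_simps)
  with 3 show ?case by simp
qed auto

lemma abs_cheb_le_1: "\<bar>x\<bar> \<le> 1 \<Longrightarrow> \<bar>cheb j x\<bar> \<le> 1"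
  by (metis abs_cos_le_one cheb_cos cos_arccos_abs)

text \<open>On \<open>[0, 1]\<close> the polynomial is a cosine, beyond \<open>1\<close> a
  hyperbolic cosine. This is where nonnegativity of the \<mu> i enters: no summand of a certificate
  can cancel a large one by more than \<open>1\<close>.\<close>

lemma cheb_ge_minus_1:
  assumes "0 \<le> x"
  shows "- 1 \<le> cheb j x"
proof (cases "x \<le> 1")
  case True
  then show ?thesis using assms abs_cheb_le_1[of x j] by simp
next
  case False
  then have "cheb j x = cosh (real j * arcosh x)"
    by (metis cheb_cosh cosh_arcosh_real linear)
  then show ?thesis using cosh_real_ge_1[of "real j * arcosh x"] by linarith
qed

lemma less_mu_max_if_cheb_sum:
  assumes "0 < t" "1 \<le> n" and nn: "\<And>i. i \<in> {1..n} \<Longrightarrow> 0 \<le> \<mu> i"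
    and S: "real n < (\<Sum>i=1..n. cheb k (\<mu> i / t))"
  shows "t < mu_max n \<mu>"
proof (rule ccontr)
  assume "\<not> t < mu_max n \<mu>"
  then have le: "\<mu> i \<le> t" if "i \<in> {1..n}" for i using mu_max_ge[OF that, of \<mu>] by linarith
  have "(\<Sum>i=1..n. cheb k (\<mu> i / t)) \<le> (\<Sum>i=1..n. 1)"
  proof (rule sum_mono)
    fix i assume i: "i \<in> {1..n}"
    then have "\<bar>\<mu> i / t\<bar> \<le> 1" using le[OF i] nn[OF i] assms(1) by simp
    from abs_cheb_le_1[OF this, of k] show "cheb k (\<mu> i / t) \<le> 1" by simp
  qed
  with S show False by simp
qed

text \<open>Half-angle form \<open>cosh u = 1 + 2 * (sinh (u/2))\<^sup>2\<close> together with
  \<open>sinh v \<le> v * exp v\<close>; on the given range \<open>exp u \<le> 3 ^ 3 = 27\<close>,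
  whence \<open>2 * 27 / 4 = 27 / 2\<close>.\<close>

lemma cosh_le_quadratic:
  fixes u :: real
  assumes "0 \<le> u" "u \<le> 3"
  shows "cosh u \<le> 1 + 27 / 2 * u\<^sup>2"
proof -
  define v where "v = u / 2"
  have v: "0 \<le> v" and u: "u = 2 * v" using assms by (auto simp: v_def)
  have "sinh v \<le> v * exp v"
  proof -
    \<comment> \<open>Used through
      \<open>2 * sinh v = exp v * (1 - exp (- (2 * v)))\<close>.\<close>
    have "1 + (- (2 * v)) \<le> exp (- (2 * v))" by (rule exp_ge_add_one_self)
    then have "exp v * (1 - exp (- (2 * v))) \<le> exp v * (2 * v)"
      by (intro mult_left_mono) auto
    moreover have "exp v * exp (- (2 * v)) = exp (- v)"
      by (simp flip: exp_add)
    ultimately show ?thesis by (simp add: sinh_def algebra_simps)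
  qed
  then have "(sinh v)\<^sup>2 \<le> (v * exp v)\<^sup>2" using v by (intro power_mono) auto
  also have "(v * exp v)\<^sup>2 = v\<^sup>2 * exp u"
    by (simp add: power_mult_distrib u flip: exp_of_nat_mult)
  also have "\<dots> \<le> v\<^sup>2 * exp 3" using assms by (intro mult_left_mono) auto
  also have "exp (3::real) = exp 1 ^ 3" by (simp flip: exp_of_nat_mult)
  also have "v\<^sup>2 * exp 1 ^ 3 \<le> v\<^sup>2 * 3 ^ 3"
    by (intro mult_left_mono power_mono exp_le) auto
  finally have "(sinh v)\<^sup>2 \<le> 27 * v\<^sup>2" by simp
  moreover have "cosh u = 1 + 2 * (sinh v)\<^sup>2"
    unfolding u cosh_double_cosh using cosh_square_eq[of v] by simp
  ultimately show ?thesis by (simp add: u power_mult_distrib)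
qed

text \<open>All summands but the largest are at least \<open>- 1\<close>, so
  \<open>cheb k y \<le> 2 * n\<close> for \<open>y = mu_max n \<mu> / t\<close>. Writing
  \<open>y = cosh u\<close> gives \<open>exp (k * u) \<le> 4 * n \<le> n ^ 3\<close>, hence
  \<open>u \<le> 3 * ln n / k < 3\<close>, and \<open>cosh_le_quadratic\<close> applies. The
  constant 122 rounds up \<open>9 * 27 / 2\<close>.\<close>

lemma mu_max_le_if_cheb_sum:
  assumes "0 < t" "2 \<le> n" "1 \<le> k" "ln (real n) < real k"
    and nn: "\<And>i. i \<in> {1..n} \<Longrightarrow> 0 \<le> \<mu> i"
    and S: "(\<Sum>i=1..n. cheb k (\<mu> i / t)) \<le> real n"
  shows "mu_max n \<mu> \<le> (1 + 122 * (ln (real n) / real k)\<^sup>2) * t"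
proof (cases "mu_max n \<mu> \<le> t")
  case True
  also have "t \<le> (1 + 122 * (ln (real n) / real k)\<^sup>2) * t"
    using assms(1) by (simp add: algebra_simps)
  finally show ?thesis .
next
  case False
  obtain i0 where i0: "i0 \<in> {1..n}" "mu_max n \<mu> = \<mu> i0"
    using mu_max_attained[of n \<mu>] assms(2) by auto
  define y where "y = \<mu> i0 / t"
  have y: "1 \<le> y" using False i0 assms(1) by (simp add: y_def)
  define u where "u = arcosh y"
  have u: "0 \<le> u" "cosh u = y" using y by (auto simp: u_def)
  have "(\<Sum>i\<in>{1..n} - {i0}. - 1) \<le> (\<Sum>i\<in>{1..n} - {i0}. cheb k (\<mu> i / t))"
    using nn assms(1) by (intro sum_mono cheb_ge_minus_1) auto
  then have "- real (n - 1) \<le> (\<Sum>i\<in>{1..n} - {i0}. cheb k (\<mu> i / t))"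
    using i0(1) by simp
  moreover have "(\<Sum>i=1..n. cheb k (\<mu> i / t)) = cheb k y + (\<Sum>i\<in>{1..n} - {i0}. cheb k (\<mu> i / t))"
    unfolding y_def using i0(1) by (intro sum.remove) auto
  ultimately have "cheb k y \<le> 2 * real n" using S by simp
  then have "cosh (real k * u) \<le> 2 * real n"
    using cheb_cosh[of k u] u by simp
  then have "exp (real k * u) \<le> 4 * real n"
    unfolding cosh_def using exp_gt_zero[of "- (real k * u)"] by (simp del: exp_gt_zero)
  \<comment> \<open>Absorbing the factor 4 needs \<open>n \<ge> 2\<close> and leaves a pure multiple
    of \<open>ln n\<close> after taking logarithms.\<close>
  also have "4 * real n \<le> real n ^ 3"
  proof -
    have "4 * real n \<le> (real n)\<^sup>2 * real n"
      using assms(2) power_mono[of 2 "real n" 2] by (intro mult_right_mono) auto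
    then show ?thesis by (simp add: power2_eq_square power3_eq_cube)
  qed
  also have "real n ^ 3 = exp (3 * ln (real n))"
    using assms(2) by (simp add: exp_of_nat_mult[of 3, simplified] )
  finally have "real k * u \<le> 3 * ln (real n)" by simp
  then have u_le: "u \<le> 3 * (ln (real n) / real k)"
    using assms(3) by (simp add: field_simps)
  moreover have L: "ln (real n) / real k < 1" "0 \<le> ln (real n) / real k"
    using assms by auto
  ultimately have "u \<le> 3" by linarith
  from cosh_le_quadratic[OF u(1) this] have "y \<le> 1 + 27 / 2 * u\<^sup>2" using u by simp
  also have "u\<^sup>2 \<le> (3 * (ln (real n) / real k))\<^sup>2"
    using u u_le by (intro power_mono) auto
  finally have "y \<le> 1 + 243 / 2 * (ln (real n) / real k)\<^sup>2"
    by (simp add: power_mult_distrib power_divide)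
  also have "\<dots> \<le> 1 + 122 * (ln (real n) / real k)\<^sup>2"
    by (intro add_left_mono mult_right_mono) auto
  finally have "y * t \<le> (1 + 122 * (ln (real n) / real k)\<^sup>2) * t"
    using assms(1) by (intro mult_right_mono) auto
  then show ?thesis using i0 assms(1) by (simp add: y_def)
qed

text \<open>To be used with \<open>L = ln n / k\<close> and \<open>K = k\<close>. The second factor
  is at most \<open>1 + 4 * L\<^sup>2\<close>, and \<open>L < 1\<close> reduces the quartic term to
  a quadratic one: \<open>126 + 488 = 614\<close>.\<close>

lemma quadratic_factors_le:
  fixes L K :: real
  assumes "0 \<le> L" "L < 1" "1 / K \<le> 2 * L" "1 \<le> K"
  shows "(1 + 122 * L\<^sup>2) * (1 + 1 / (K * K)) \<le> 1 + 614 * L\<^sup>2"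
proof -
  have "1 / (K * K) = (1 / K)\<^sup>2" by (simp add: power2_eq_square)
  also have "\<dots> \<le> (2 * L)\<^sup>2" using assms by (intro power_mono) auto
  finally have "(1 + 122 * L\<^sup>2) * (1 + 1 / (K * K)) \<le> (1 + 122 * L\<^sup>2) * (1 + 4 * L\<^sup>2)"
    by (intro mult_left_mono) (auto simp: power_mult_distrib)
  also have "\<dots> = 1 + 126 * L\<^sup>2 + 488 * (L\<^sup>2 * L\<^sup>2)" by (simp add: algebra_simps)
  also have "L\<^sup>2 * L\<^sup>2 \<le> L\<^sup>2 * 1"
    using assms by (intro mult_left_mono) (auto simp: power_le_one)
  finally show ?thesis by simp
qed

subsection \<open>Weakest preconditions with running time\<close>

text \<open>Total correctness; the postcondition also receives the running time.\<close>

definition wp :: "com \<Rightarrow> state \<Rightarrow> (nat \<Rightarrow> state \<Rightarrow> bool) \<Rightarrow> bool" where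
  "wp c s Q \<longleftrightarrow> (\<exists>t s'. exec c s t s' \<and> Q t s')"

text \<open>Determinism makes this an equivalence, so that straight-line code can be handled by
  rewriting.\<close>

lemma wp_exec: "exec c s t s' \<Longrightarrow> wp c s Q \<longleftrightarrow> Q t s'"
  unfolding wp_def using exec_deterministic by blast

lemmas wp_SKIP = wp_exec[OF exec.Skip]
lemmas wp_IAssign = wp_exec[OF exec.IAssign]
lemmas wp_RAssign = wp_exec[OF exec.RAssign]

lemma wp_Seq: "wp (Seq c d) s Q \<longleftrightarrow> wp c s (\<lambda>t s'. wp d s' (\<lambda>t' s''. Q (t + t') s''))"
proof
  assume "wp (Seq c d) s Q"
  then obtain t s' where "exec (Seq c d) s t s'" "Q t s'" unfolding wp_def by blast
  then show "wp c s (\<lambda>t s'. wp d s' (\<lambda>t' s''. Q (t + t') s''))"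
    unfolding wp_def by cases blast
qed (auto simp: wp_def intro: exec.Seq)

lemma wp_If: "wp (IfC b c d) s Q \<longleftrightarrow>
    (if bval b s then wp c s (\<lambda>t s'. Q (1 + bcost b + t) s')
     else wp d s (\<lambda>t s'. Q (1 + bcost b + t) s'))"
proof
  assume "wp (IfC b c d) s Q"
  then obtain t s' where "exec (IfC b c d) s t s'" "Q t s'" unfolding wp_def by blast
  then show "if bval b s then wp c s (\<lambda>t s'. Q (1 + bcost b + t) s')
     else wp d s (\<lambda>t s'. Q (1 + bcost b + t) s')"
    unfolding wp_def by cases (simp only: if_True if_False, blast)+
next
  assume "if bval b s then wp c s (\<lambda>t s'. Q (1 + bcost b + t) s')
     else wp d s (\<lambda>t s'. Q (1 + bcost b + t) s')"
  then show "wp (IfC b c d) s Q"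
    unfolding wp_def by (metis exec.IfTrue exec.IfFalse)
qed

lemmas wp_simps = wp_IAssign wp_RAssign wp_Seq wp_If wp_SKIP

lemma wp_mono: "wp c s Q \<Longrightarrow> (\<And>t s'. Q t s' \<Longrightarrow> R t s') \<Longrightarrow> wp c s R"
  unfolding wp_def by blast

text \<open>The index \<open>j\<close> counts finished rounds. As the invariant and the guard force
  \<open>j < N\<close>, the difference \<open>N - j\<close> is a termination measure and also bounds
  the remaining rounds; the last summand pays for the failing test.\<close>

lemma wp_While:
  assumes init: "I 0 s"
    and step: "\<And>j s. I j s \<Longrightarrow> bval b s \<Longrightarrow> j < N \<and> wp c s (\<lambda>t s'. t \<le> T \<and> I (Suc j) s')"
    and stop: "\<And>j s. I j s \<Longrightarrow> \<not> bval b s \<Longrightarrow> Q s"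
  shows "wp (While b c) s (\<lambda>t s'. t \<le> N * (1 + bcost b + T) + (1 + bcost b) \<and> Q s')"
proof -
  have "wp (While b c) s (\<lambda>t s'. t \<le> (N - j) * (1 + bcost b + T) + (1 + bcost b) \<and> Q s')"
    if "I j s" for j s
    using that
  proof (induction "N - j" arbitrary: j s rule: less_induct)
    case less
    show ?case
    proof (cases "bval b s")
      case False
      then show ?thesis
        unfolding wp_def using stop[OF less.prems] exec.WhileFalse[of b s c] by fastforce
    next
      case True
      from step[OF less.prems True] obtain t s' where
        j: "j < N" and c: "exec c s t s'" "t \<le> T" "I (Suc j) s'"
        unfolding wp_def by blast
      have "N - Suc j < N - j" using j by simp
      from less.hyps[OF this c(3)] obtain t' s'' where
        w: "exec (While b c) s' t' s''" "Q s''"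
           "t' \<le> (N - Suc j) * (1 + bcost b + T) + (1 + bcost b)"
        unfolding wp_def by blast
      have "N - j = Suc (N - Suc j)" using j by simp
      then have "1 + bcost b + t + t' \<le> (N - j) * (1 + bcost b + T) + (1 + bcost b)"
        using w(3) c(2) by simp
      then show ?thesis
        unfolding wp_def using exec.WhileTrue[OF True c(1) w(1)] w(2) by blast
    qed
  qed
  from this[OF init] show ?thesis by simp
qed

text \<open>A frame condition: only the registers in \<open>X\<close> and the arrays in
  \<open>A\<close> may be modified.\<close>

definition unchanged :: "vname set \<Rightarrow> vname set \<Rightarrow> state \<Rightarrow> state \<Rightarrow> bool" where
  "unchanged X A s s' \<longleftrightarrow>
     (\<forall>x. x \<notin> X \<longrightarrow> fst s' x = fst s x) \<and> (\<forall>x. x \<notin> A \<longrightarrow> snd s' x = snd s x)"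

subsection \<open>Computing the power sums\<close>

definition incr :: "vname \<Rightarrow> com" where
  "incr x = IAssign x (IAdd (IVar x) (IConst 1))"

definition newton_inner :: com where
  "newton_inner = While (ILess (IVar ''i'') (IVar ''m''))
     (Seq (RAssign ''p'' (IVar ''m'')
            (RSub (Cell ''p'' (IVar ''m''))
              (RMul (Cell ''p'' (IVar ''i'')) (Cell ''e'' (ISub (IVar ''m'') (IVar ''i''))))))
          (incr ''i''))"

text \<open>Cell 0 receives \<open>n\<close>, the power sum of exponent 0. It is the denominator of
  the estimate when \<open>k = 1\<close> and the moment of \<open>T_0\<close> in the
  certificates.\<close>

definition newton_prog :: com where
  "newton_prog =
     Seq (RAssign ''p'' (IConst 0) (OfNat (IVar ''n'')))
    (Seq (IAssign ''m'' (IConst 1))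
    (While (ILess (IVar ''m'') (IAdd (IVar ''k'') (IConst 1)))
      (Seq (RAssign ''p'' (IVar ''m'')
             (RSub (OfNat (IConst 0)) (RMul (OfNat (IVar ''m'')) (Cell ''e'' (IVar ''m'')))))
      (Seq (IAssign ''i'' (IConst 1))
      (Seq newton_inner
           (incr ''m''))))))"

text \<open>The loop writes only cell \<open>m\<close> of \<open>p\<close> and reads, besides it,
  only cells below \<open>m\<close>, so the sum may refer to the initial array.\<close>

lemma newton_inner_correct:
  assumes "fst s ''i'' = 1" "1 \<le> fst s ''m''" "fst s ''m'' \<le> K"
  shows "wp newton_inner s (\<lambda>t s'. t \<le> K * 20 + 4 \<and>
    unchanged {''i''} {''p''} s s' \<and>
    snd s' ''p'' = (snd s ''p'')(fst s ''m'' := snd s ''p'' (fst s ''m'') -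
      (\<Sum>i=1..<fst s ''m''. snd s ''p'' i * snd s ''e'' (fst s ''m'' - i))))"
proof -
  let ?m = "fst s ''m''"
  define I where "I j s' \<longleftrightarrow> fst s' ''i'' = Suc j \<and> Suc j \<le> ?m \<and> unchanged {''i''} {''p''} s s' \<and>
    snd s' ''p'' = (snd s ''p'')(?m := snd s ''p'' ?m -
      (\<Sum>i=1..<Suc j. snd s ''p'' i * snd s ''e'' (?m - i)))" for j s'
  have "wp newton_inner s (\<lambda>t s'. t \<le> K * (1 + bcost (ILess (IVar ''i'') (IVar ''m'')) + 16) +
      (1 + bcost (ILess (IVar ''i'') (IVar ''m''))) \<and>
      (unchanged {''i''} {''p''} s s' \<and>
       snd s' ''p'' = (snd s ''p'')(?m := snd s ''p'' ?m -
      (\<Sum>i=1..<?m. snd s ''p'' i * snd s ''e'' (?m - i)))))"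
    unfolding newton_inner_def
  proof (rule wp_While[where I = I])
    show "I 0 s" using assms by (simp add: I_def unchanged_def)
  next
    fix j s' assume I: "I j s'" and b: "bval (ILess (IVar ''i'') (IVar ''m'')) s'"
    then show "j < K \<and> wp (Seq (RAssign ''p'' (IVar ''m'')
            (RSub (Cell ''p'' (IVar ''m''))
              (RMul (Cell ''p'' (IVar ''i'')) (Cell ''e'' (ISub (IVar ''m'') (IVar ''i''))))))
          (incr ''i'')) s' (\<lambda>t s'. t \<le> 16 \<and> I (Suc j) s')"
      using assms by (auto simp: I_def unchanged_def wp_simps incr_def fun_eq_iff)
  next
    fix j s' assume I: "I j s'" and b: "\<not> bval (ILess (IVar ''i'') (IVar ''m'')) s'"
    then have "Suc j = ?m" by (auto simp: I_def unchanged_def)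
    with I show "unchanged {''i''} {''p''} s s' \<and>
       snd s' ''p'' = (snd s ''p'')(?m := snd s ''p'' ?m -
      (\<Sum>i=1..<?m. snd s ''p'' i * snd s ''e'' (?m - i)))"
      by (simp add: I_def)
  qed
  then show ?thesis by (rule wp_mono) auto
qed


lemma newton_prog_correct:
  assumes n: "fst s ''n'' = n" and k: "fst s ''k'' = k"
    and e: "\<And>i. 1 \<le> i \<Longrightarrow> i \<le> k \<Longrightarrow> snd s ''e'' i = esym n \<mu> i"
  shows "wp newton_prog s (\<lambda>t s'. t \<le> k * (k * 20 + 30) + 20 \<and>
    unchanged {''i'', ''m''} {''p''} s s' \<and>
    (\<forall>a\<le>k. snd s' ''p'' a = signed_power_sum n \<mu> a))"
proof -
  let ?b = "ILess (IVar ''m'') (IAdd (IVar ''k'') (IConst 1))"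
  let ?body = "Seq (RAssign ''p'' (IVar ''m'')
             (RSub (OfNat (IConst 0)) (RMul (OfNat (IVar ''m'')) (Cell ''e'' (IVar ''m'')))))
      (Seq (IAssign ''i'' (IConst 1))
      (Seq newton_inner
           (incr ''m'')))"
  define s1 where "s1 = ((fst s)(''m'' := 1), (snd s)(''p'' := (snd s ''p'')(0 := real n)))"
  define I where "I j s' \<longleftrightarrow> fst s' ''m'' = Suc j \<and> j \<le> k \<and> unchanged {''i'', ''m''} {''p''} s s' \<and>
    (\<forall>a\<le>j. snd s' ''p'' a = signed_power_sum n \<mu> a)" for j s'
  have "wp (While ?b ?body) s1 (\<lambda>t s'. t \<le> k * (1 + bcost ?b + (k * 20 + 22)) + (1 + bcost ?b) \<and>
     (unchanged {''i'', ''m''} {''p''} s s' \<and> (\<forall>a\<le>k. snd s' ''p'' a = signed_power_sum n \<mu> a)))"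
  proof (rule wp_While[where I = I])
    show "I 0 s1"
      using assms by (simp add: I_def s1_def unchanged_def signed_power_sum_def)
  next
    fix j s' assume I: "I j s'" and b: "bval ?b s'"
    have I1: "fst s' ''m'' = Suc j" "fst s' ''k'' = k"
        "\<And>i. 1 \<le> i \<Longrightarrow> i \<le> k \<Longrightarrow> snd s' ''e'' i = esym n \<mu> i"
        "\<And>a. a \<le> j \<Longrightarrow> snd s' ''p'' a = signed_power_sum n \<mu> a"
        "unchanged {''i'', ''m''} {''p''} s s'"
      using I assms by (auto simp: I_def unchanged_def)
    have jk: "j < k" using b I1 by simp
    define s2 where "s2 = ((fst s')(''i'' := 1),
      (snd s')(''p'' := (snd s' ''p'')(Suc j := 0 - real (Suc j) * snd s' ''e'' (Suc j))))"
    \<comment> \<open>The cells read lie below \<open>Suc j\<close>, where \<open>p\<close> is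
      already correct, and \<open>e\<close> is read at indices between 1 and \<open>k\<close> only,
      where it agrees with \<open>esym\<close>.\<close>
    have sum_eq: "(\<Sum>i=1..<Suc j. snd s2 ''p'' i * snd s2 ''e'' (Suc j - i)) =
        (\<Sum>i=1..<Suc j. signed_power_sum n \<mu> i * esym n \<mu> (Suc j - i))"
    proof (rule sum.cong[OF refl])
      fix i assume "i \<in> {1..<Suc j}"
      then have "i \<le> j" "1 \<le> i" "1 \<le> Suc j - i" "Suc j - i \<le> k" "i \<noteq> Suc j" using jk by auto
      then show "snd s2 ''p'' i * snd s2 ''e'' (Suc j - i) =
          signed_power_sum n \<mu> i * esym n \<mu> (Suc j - i)"
        by (simp add: s2_def I1)
    qed
    have new: "snd s2 ''p'' (Suc j) - (\<Sum>i=1..<Suc j. snd s2 ''p'' i * snd s2 ''e'' (Suc j - i)) =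
        signed_power_sum n \<mu> (Suc j)"
      unfolding sum_eq using signed_power_sum_rec[of "Suc j" n \<mu>] jk I1(3)[of "Suc j"]
      by (simp add: s2_def)
    have inner: "wp newton_inner s2 (\<lambda>t s'. t \<le> k * 20 + 4 \<and>
        unchanged {''i''} {''p''} s2 s' \<and>
        snd s' ''p'' = (snd s2 ''p'')(Suc j := signed_power_sum n \<mu> (Suc j)))"
      using newton_inner_correct[of s2 k] jk new by (simp add: s2_def I1)
    have "wp ?body s' (\<lambda>t s'. t \<le> k * 20 + 22 \<and> I (Suc j) s')"
    proof -
      have "wp newton_inner s2 (\<lambda>t s''. wp (incr ''m'') s'' (\<lambda>t' s''. 14 + t + t' \<le> k * 20 + 22 \<and> I (Suc j) s''))"
      proof (rule wp_mono[OF inner], elim conjE)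
        fix t s'' assume t: "t \<le> k * 20 + 4" and u: "unchanged {''i''} {''p''} s2 s''"
          and p: "snd s'' ''p'' = (snd s2 ''p'')(Suc j := signed_power_sum n \<mu> (Suc j))"
        have "I (Suc j) ((fst s'')(''m'' := Suc (Suc j)), snd s'')"
          unfolding I_def
        proof (intro conjI allI impI)
          show "unchanged {''i'', ''m''} {''p''} s ((fst s'')(''m'' := Suc (Suc j)), snd s'')"
            using u I1(5) by (auto simp: unchanged_def s2_def)
        next
          fix a assume "a \<le> Suc j"
          then show "snd ((fst s'')(''m'' := Suc (Suc j)), snd s'') ''p'' a = signed_power_sum n \<mu> a"
            using I1(4)[of a] by (cases "a = Suc j") (simp_all add: p s2_def)
        qed (use jk in simp_all)
        moreover have "fst s'' ''m'' = Suc j" using u I1(1) by (simp add: unchanged_def s2_def)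
        ultimately show "wp (incr ''m'') s'' (\<lambda>t' s''. 14 + t + t' \<le> k * 20 + 22 \<and> I (Suc j) s'')"
          using t by (simp add: wp_IAssign incr_def)
      qed
      then show ?thesis
        unfolding wp_Seq wp_RAssign wp_IAssign
        by (auto simp: s2_def I1(1) elim!: wp_mono)
    qed
    with jk show "j < k \<and> wp ?body s' (\<lambda>t s'. t \<le> k * 20 + 22 \<and> I (Suc j) s')" by simp
  next
    fix j s' assume I: "I j s'" and b: "\<not> bval ?b s'"
    then have "j = k" using k by (auto simp: I_def unchanged_def)
    with I show "unchanged {''i'', ''m''} {''p''} s s' \<and> (\<forall>a\<le>k. snd s' ''p'' a = signed_power_sum n \<mu> a)"
      by (simp add: I_def)
  qed
  then show ?thesis
    unfolding newton_prog_def wp_Seq wp_RAssign wp_IAssign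
    by (auto simp: s1_def n algebra_simps elim!: wp_mono)
qed

subsection \<open>Evaluating a certificate\<close>

text \<open>
  Working with the powers of \<open>- \<mu> i\<close> keeps all signs out of the programs. The moments turn the three-term recurrence
  for \<open>T\<^sub>j\<close> into one between real arrays, which can be overwritten in place.
\<close>

definition cheb_moment :: "nat \<Rightarrow> (nat \<Rightarrow> real) \<Rightarrow> real \<Rightarrow> nat \<Rightarrow> nat \<Rightarrow> real" where
  "cheb_moment n \<mu> t j a = (\<Sum>i=1..n. (- \<mu> i) ^ a * cheb j (\<mu> i / t))"

lemma cheb_moment_0: "cheb_moment n \<mu> t 0 a = signed_power_sum n \<mu> a"
  by (simp add: cheb_moment_def signed_power_sum_def)

lemma cheb_moment_1: "cheb_moment n \<mu> t (Suc 0) a = 0 - signed_power_sum n \<mu> (Suc a) / t"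
proof -
  have "(- \<mu> i) ^ a * cheb (Suc 0) (\<mu> i / t) = - 1 / t * (- \<mu> i) ^ Suc a" for i
    by simp
  then have "cheb_moment n \<mu> t (Suc 0) a = - 1 / t * signed_power_sum n \<mu> (Suc a)"
    unfolding cheb_moment_def signed_power_sum_def by (simp only: sum_distrib_left)
  then show ?thesis by simp
qed

text \<open>A factor \<open>\<mu> i\<close> raises the exponent of \<open>- \<mu> i\<close> by one
  and flips the sign. Each step thus costs one exponent, and power sums up to \<open>k\<close> are
  just enough for moment 0 of \<open>T_k\<close>.\<close>

lemma cheb_moment_Suc_Suc:
  "cheb_moment n \<mu> t (Suc (Suc j)) a =
     0 - 2 * cheb_moment n \<mu> t (Suc j) (Suc a) / t - cheb_moment n \<mu> t j a"
proof -
  have "(- \<mu> i) ^ a * cheb (Suc (Suc j)) (\<mu> i / t) =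
      - 2 / t * ((- \<mu> i) ^ Suc a * cheb (Suc j) (\<mu> i / t)) - (- \<mu> i) ^ a * cheb j (\<mu> i / t)" for i
    by (simp add: algebra_simps)
  then have "cheb_moment n \<mu> t (Suc (Suc j)) a =
      - 2 / t * cheb_moment n \<mu> t (Suc j) (Suc a) - cheb_moment n \<mu> t j a"
    unfolding cheb_moment_def by (simp only: sum_subtractf sum_distrib_left)
  then show ?thesis by simp
qed

text \<open>\<open>A\<close> holds the newer and \<open>B\<close> the older polynomial's moments.
  The new value waits in \<open>c\<close> until the old \<open>A\<close> has been moved to
  \<open>B\<close>.\<close>

definition cheb_inner :: com where
  "cheb_inner = While (ILess (IVar ''a'') (ISub (IVar ''k'') (IVar ''j'')))
     (Seq (RAssign ''c'' (IConst 0)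
            (RSub (RSub (OfNat (IConst 0))
                (RDiv (RMul (OfNat (IConst 2)) (Cell ''A'' (IAdd (IVar ''a'') (IConst 1))))
                  (Cell ''t'' (IConst 0))))
              (Cell ''B'' (IVar ''a''))))
     (Seq (RAssign ''B'' (IVar ''a'') (Cell ''A'' (IVar ''a'')))
     (Seq (RAssign ''A'' (IVar ''a'') (Cell ''c'' (IConst 0)))
          (incr ''a''))))"

definition cheb_init :: com where
  "cheb_init = While (ILess (IVar ''a'') (IVar ''k''))
     (Seq (RAssign ''B'' (IVar ''a'') (Cell ''p'' (IVar ''a'')))
     (Seq (RAssign ''A'' (IVar ''a'')
            (RSub (OfNat (IConst 0))
              (RDiv (Cell ''p'' (IAdd (IVar ''a'') (IConst 1))) (Cell ''t'' (IConst 0)))))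
          (incr ''a'')))"

definition cheb_prog :: com where
  "cheb_prog =
     Seq (IAssign ''a'' (IConst 0))
    (Seq cheb_init
    (Seq (IAssign ''j'' (IConst 1))
    (While (ILess (IVar ''j'') (IVar ''k''))
      (Seq (IAssign ''a'' (IConst 0))
      (Seq cheb_inner
           (incr ''j''))))))"

text \<open>Sweeping upwards is safe in place: the new cell \<open>a\<close> needs the old cell
  \<open>a + 1\<close> of \<open>A\<close>, which is not overwritten before the next round.\<close>

lemma cheb_inner_correct:
  assumes "fst s ''a'' = 0" "fst s ''k'' = k" "fst s ''j'' = J" "J \<le> k" "snd s ''t'' 0 = t"
    and F: "\<And>a. a \<le> k - J \<Longrightarrow> snd s ''A'' a = F a"
    and G: "\<And>a. a \<le> k - J \<Longrightarrow> snd s ''B'' a = G a"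
  shows "wp cheb_inner s (\<lambda>t' s'. t' \<le> k * 40 + 6 \<and> unchanged {''a''} {''A'', ''B'', ''c''} s s' \<and>
    (\<forall>a<k - J. snd s' ''A'' a = 0 - 2 * F (Suc a) / t - G a \<and> snd s' ''B'' a = F a))"
proof -
  let ?b = "ILess (IVar ''a'') (ISub (IVar ''k'') (IVar ''j''))"
  let ?body = "(Seq (RAssign ''c'' (IConst 0)
            (RSub (RSub (OfNat (IConst 0))
                (RDiv (RMul (OfNat (IConst 2)) (Cell ''A'' (IAdd (IVar ''a'') (IConst 1))))
                  (Cell ''t'' (IConst 0))))
              (Cell ''B'' (IVar ''a''))))
     (Seq (RAssign ''B'' (IVar ''a'') (Cell ''A'' (IVar ''a'')))
     (Seq (RAssign ''A'' (IVar ''a'') (Cell ''c'' (IConst 0)))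
          (incr ''a''))))"
  define I where "I i s' \<longleftrightarrow> fst s' ''a'' = i \<and> i \<le> k - J \<and>
    unchanged {''a''} {''A'', ''B'', ''c''} s s' \<and>
    (\<forall>a<i. snd s' ''A'' a = 0 - 2 * F (Suc a) / t - G a \<and> snd s' ''B'' a = F a) \<and>
    (\<forall>a. i \<le> a \<longrightarrow> a \<le> k - J \<longrightarrow> snd s' ''A'' a = F a \<and> snd s' ''B'' a = G a)" for i s'
  have "wp cheb_inner s (\<lambda>t' s'. t' \<le> k * (1 + bcost ?b + 33) + (1 + bcost ?b) \<and>
    (unchanged {''a''} {''A'', ''B'', ''c''} s s' \<and>
    (\<forall>a<k - J. snd s' ''A'' a = 0 - 2 * F (Suc a) / t - G a \<and> snd s' ''B'' a = F a)))"
    unfolding cheb_inner_def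
  proof (rule wp_While[where I = I])
    show "I 0 s" using assms by (simp add: I_def unchanged_def)
  next
    fix i s' assume I: "I i s'" and b: "bval ?b s'"
    have s': "fst s' ''a'' = i" "fst s' ''k'' = k" "fst s' ''j'' = J" "snd s' ''t'' 0 = t"
      using I assms by (auto simp: I_def unchanged_def)
    have i: "i < k - J" using b s' by simp
    have AB: "snd s' ''A'' i = F i" "snd s' ''A'' (Suc i) = F (Suc i)" "snd s' ''B'' i = G i"
      using I i by (auto simp: I_def)
    have "wp ?body s' (\<lambda>t s'. t \<le> 33 \<and> I (Suc i) s')"
    proof -
      define v where "v = 0 - 2 * F (Suc i) / t - G i"
      have "I (Suc i) ((fst s')(''a'' := Suc i), (snd s')(''c'' := (snd s' ''c'')(0 := v),
          ''B'' := (snd s' ''B'')(i := F i), ''A'' := (snd s' ''A'')(i := v)))"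
        unfolding I_def
      proof (intro conjI allI impI, goal_cases)
        case 3
        then show ?case using I unfolding I_def unchanged_def by simp
      next
        case (4 a)
        then show ?case using I unfolding I_def by (cases "a = i") (simp_all add: v_def)
      next
        case (5 a)
        then show ?case using I unfolding I_def by (cases "a = i") simp_all
      next
        case (6 a)
        then show ?case using I unfolding I_def by simp
      next
        case (7 a)
        then show ?case using I unfolding I_def by simp
      qed (use i in simp_all)
      then show ?thesis
        by (simp add: wp_Seq wp_RAssign wp_IAssign incr_def s' AB v_def)
    qed
    with i show "i < k \<and> wp ?body s' (\<lambda>t s'. t \<le> 33 \<and> I (Suc i) s')" by simp
  next
    fix i s' assume I: "I i s'" and b: "\<not> bval ?b s'"
    then have "i = k - J" using assms by (auto simp: I_def unchanged_def)
    with I show "unchanged {''a''} {''A'', ''B'', ''c''} s s' \<and>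
    (\<forall>a<k - J. snd s' ''A'' a = 0 - 2 * F (Suc a) / t - G a \<and> snd s' ''B'' a = F a)"
      by (simp add: I_def)
  qed
  then show ?thesis by (rule wp_mono) auto
qed

lemma cheb_init_correct:
  assumes "fst s ''a'' = 0" "fst s ''k'' = k"
  shows "wp cheb_init s (\<lambda>t' s'. t' \<le> k * 40 + 4 \<and> unchanged {''a''} {''A'', ''B''} s s' \<and>
    (\<forall>a<k. snd s' ''A'' a = 0 - snd s ''p'' (Suc a) / snd s ''t'' 0 \<and> snd s' ''B'' a = snd s ''p'' a))"
proof -
  let ?b = "ILess (IVar ''a'') (IVar ''k'')"
  define I where "I i s' \<longleftrightarrow> fst s' ''a'' = i \<and> i \<le> k \<and> unchanged {''a''} {''A'', ''B''} s s' \<and>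
    (\<forall>a<i. snd s' ''A'' a = 0 - snd s ''p'' (Suc a) / snd s ''t'' 0 \<and>
      snd s' ''B'' a = snd s ''p'' a)" for i s'
  have "wp cheb_init s (\<lambda>t' s'. t' \<le> k * (1 + bcost ?b + 36) + (1 + bcost ?b) \<and>
    (unchanged {''a''} {''A'', ''B''} s s' \<and>
    (\<forall>a<k. snd s' ''A'' a = 0 - snd s ''p'' (Suc a) / snd s ''t'' 0 \<and> snd s' ''B'' a = snd s ''p'' a)))"
    unfolding cheb_init_def
    by (rule wp_While[where I = I])
      (use assms in \<open>auto simp: I_def unchanged_def wp_simps incr_def less_Suc_eq\<close>)
  then show ?thesis by (rule wp_mono) auto
qed

lemma cheb_prog_correct:
  assumes k: "fst s ''k'' = k" "1 \<le> k" and t: "snd s ''t'' 0 = t"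
    and p: "\<And>a. a \<le> k \<Longrightarrow> snd s ''p'' a = signed_power_sum n \<mu> a"
  shows "wp cheb_prog s (\<lambda>t' s'. t' \<le> k * (k * 40 + 60) + 12 \<and>
    unchanged {''a'', ''j''} {''A'', ''B'', ''c''} s s' \<and>
    snd s' ''A'' 0 = (\<Sum>i=1..n. cheb k (\<mu> i / t)))"
proof -
  let ?M = "cheb_moment n \<mu> t"
  let ?b = "ILess (IVar ''j'') (IVar ''k'')"
  let ?body = "Seq (IAssign ''a'' (IConst 0)) (Seq cheb_inner (incr ''j''))"
  \<comment> \<open>After \<open>i\<close> rounds the arrays belong to \<open>T_(i+1)\<close> and
    \<open>T_i\<close>. The valid range of exponents shrinks by one per round and is reduced to
    \<open>0\<close> when \<open>i + 1 = k\<close>.\<close>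
  define I where "I i s' \<longleftrightarrow> fst s' ''j'' = Suc i \<and> Suc i \<le> k \<and>
    unchanged {''a'', ''j''} {''A'', ''B'', ''c''} s s' \<and>
    (\<forall>a\<le>k - Suc i. snd s' ''A'' a = ?M (Suc i) a \<and> snd s' ''B'' a = ?M i a)" for i s'
  have loop: "wp (While ?b ?body) s1 (\<lambda>t' s'. t' \<le> k * (1 + bcost ?b + (k * 40 + 12)) + (1 + bcost ?b) \<and>
     (unchanged {''a'', ''j''} {''A'', ''B'', ''c''} s s' \<and> snd s' ''A'' 0 = ?M k 0))"
    if "I 0 s1" for s1
  proof (rule wp_While[where I = I])
    fix i s' assume I: "I i s'" and b: "bval ?b s'"
    define s2 where "s2 = ((fst s')(''a'' := 0), snd s')"
    have s2: "fst s2 ''a'' = 0" "fst s2 ''k'' = k" "fst s2 ''j'' = Suc i" "Suc i \<le> k" "snd s2 ''t'' 0 = t"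
      "\<And>a. a \<le> k - Suc i \<Longrightarrow> snd s2 ''A'' a = ?M (Suc i) a"
      "\<And>a. a \<le> k - Suc i \<Longrightarrow> snd s2 ''B'' a = ?M i a"
      using I k t by (auto simp: I_def s2_def unchanged_def)
    have ik: "Suc i < k" using b I k by (simp add: I_def unchanged_def)
    have "wp ?body s' (\<lambda>t s'. t \<le> k * 40 + 12 \<and> I (Suc i) s')"
      unfolding wp_simps
      apply (simp flip: s2_def)
      apply (rule wp_mono[OF cheb_inner_correct[OF s2]])
      using ik I by (auto simp: wp_simps incr_def I_def unchanged_def s2_def cheb_moment_Suc_Suc)
    with ik show "i < k \<and> wp ?body s' (\<lambda>t s'. t \<le> k * 40 + 12 \<and> I (Suc i) s')" by simp
  next
    fix i s' assume I: "I i s'" and b: "\<not> bval ?b s'"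
    then have "Suc i = k" using k by (auto simp: I_def unchanged_def)
    with I show "unchanged {''a'', ''j''} {''A'', ''B'', ''c''} s s' \<and> snd s' ''A'' 0 = ?M k 0"
      by (auto simp: I_def)
  qed (fact that)
  have M: "?M k 0 = (\<Sum>i=1..n. cheb k (\<mu> i / t))" by (simp add: cheb_moment_def)
  define s0 where "s0 = ((fst s)(''a'' := 0), snd s)"
  have s0: "fst s0 ''a'' = 0" "fst s0 ''k'' = k" using k by (auto simp: s0_def)
  have I0: "I 0 ((fst s')(''j'' := Suc 0), snd s')"
    if "unchanged {''a''} {''A'', ''B''} s0 s'"
      "\<forall>a<k. snd s' ''A'' a = 0 - snd s0 ''p'' (Suc a) / snd s0 ''t'' 0 \<and> snd s' ''B'' a = snd s0 ''p'' a"
    for s'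
    using that k t p by (auto simp: I_def unchanged_def s0_def cheb_moment_0 cheb_moment_1)
  show ?thesis
    unfolding cheb_prog_def wp_simps
    apply (simp flip: s0_def)
    apply (rule wp_mono[OF cheb_init_correct[OF s0]])
    apply (elim conjE)
    apply (rule wp_mono[OF loop[OF I0]])
      apply assumption
     apply assumption
    apply (auto simp: M algebra_simps)
    done
qed

subsection \<open>Scanning for the largest certified point\<close>

text \<open>The first factor is the loss of a Chebyshev certificate, the second that of the grid
  spacing.\<close>

definition scan_factor :: "nat \<Rightarrow> nat \<Rightarrow> real" where
  "scan_factor n k = (1 + 122 * (ln (real n) / real k)\<^sup>2) * (1 + 1 / (real k * real k))"

lemma scan_factor_ge_1: "1 \<le> scan_factor n k"
proof -
  have "1 * 1 \<le> scan_factor n k"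
    unfolding scan_factor_def by (intro mult_mono) auto
  then show ?thesis by simp
qed

lemma scan_factor_le:
  assumes "2 \<le> n" "1 \<le> k" "ln (real n) < real k"
  shows "scan_factor n k \<le> 1 + 614 * (ln (real n) / real k)\<^sup>2"
  unfolding scan_factor_def
proof (rule quadratic_factors_le)
  have "1 / 2 \<le> ln (2 :: real)" using ln_le_minus_one[of "1 / 2 :: real"] by (simp add: ln_div)
  also have "\<dots> \<le> ln (real n)" using assms by simp
  finally show "1 / real k \<le> 2 * (ln (real n) / real k)"
    using assms by (simp add: field_simps)
qed (use assms in auto)

text \<open>The failed test at the next grid point bounds the maximum in terms of that point, which
  exceeds \<open>t\<close> by at most the factor \<open>1 + 1 / k\<^sup>2\<close> because
  \<open>m \<le> t\<close>.\<close>

lemma mu_max_le_scan_factor: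
  assumes "0 < m" "m \<le> t" "2 \<le> n" "1 \<le> k" "ln (real n) < real k"
    and nn: "\<And>i. i \<in> {1..n} \<Longrightarrow> 0 \<le> \<mu> i"
    and S: "(\<Sum>i=1..n. cheb k (\<mu> i / (t + m / (real k * real k)))) \<le> real n"
  shows "mu_max n \<mu> \<le> scan_factor n k * t"
proof -
  have "0 < t + m / (real k * real k)" using assms(1,2,4) by (simp add: add_pos_nonneg)
  from mu_max_le_if_cheb_sum[OF this assms(3-5) nn S]
  have "mu_max n \<mu> \<le> (1 + 122 * (ln (real n) / real k)\<^sup>2) * (t + m / (real k * real k))"
    by simp
  also have "\<dots> \<le> (1 + 122 * (ln (real n) / real k)\<^sup>2) * (t + t / (real k * real k))"
    using assms(2) by (intro mult_left_mono add_left_mono divide_right_mono) auto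
  also have "\<dots> = scan_factor n k * t"
    by (simp add: scan_factor_def algebra_simps)
  finally show ?thesis .
qed

definition scan_body :: com where
  "scan_body =
     Seq (RAssign ''t'' (IConst 0) (RAdd (Cell ''t'' (IConst 0)) (Cell ''d'' (IConst 0))))
    (Seq cheb_prog
    (IfC (RLess (OfNat (IVar ''n'')) (Cell ''A'' (IConst 0)))
      (RAssign ''out'' (IConst 0) (Cell ''t'' (IConst 0)))
      SKIP))"

definition scan_prog :: com where
  "scan_prog =
     Seq (RAssign ''out'' (IConst 0)
       (RSub (OfNat (IConst 0))
         (RDiv (Cell ''p'' (IVar ''k'')) (Cell ''p'' (ISub (IVar ''k'') (IConst 1))))))
    (Seq (RAssign ''d'' (IConst 0)
       (RDiv (Cell ''out'' (IConst 0)) (RMul (OfNat (IVar ''k'')) (OfNat (IVar ''k'')))))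
    (Seq (RAssign ''b'' (IConst 0) (RMul (OfNat (IConst 3)) (Cell ''out'' (IConst 0))))
    (Seq (RAssign ''t'' (IConst 0) (Cell ''out'' (IConst 0)))
    (While (RLess (Cell ''t'' (IConst 0)) (Cell ''b'' (IConst 0))) scan_body))))"

lemma scan_prog_correct:
  assumes n: "fst s ''n'' = n" and k: "fst s ''k'' = k" "1 \<le> k" "k < n"
    and p: "\<And>a. a \<le> k \<Longrightarrow> snd s ''p'' a = signed_power_sum n \<mu> a"
    and nn: "\<And>i. i \<in> {1..n} \<Longrightarrow> 0 \<le> \<mu> i"
  shows "wp scan_prog s (\<lambda>t s'. t \<le> 2 * k * k * (k * (k * 40 + 60) + 60) + 60 \<and>
    ratio_estimate n k \<mu> \<le> result s' \<and> result s' \<le> mu_max n \<mu> \<and>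
    (ln (real n) < real k \<longrightarrow> mu_max n \<mu> \<le> scan_factor n k * result s'))"
proof -
  define m where "m = ratio_estimate n k \<mu>"
  define d where "d = m / (real k * real k)"
  have m: "0 \<le> m" "m \<le> mu_max n \<mu>" "mu_max n \<mu> \<le> real n powr (1 / real k) * m"
    unfolding m_def using k nn
    by (auto intro!: ratio_estimate_nonneg ratio_estimate_le mu_max_le_ratio_estimate)
  have mu_max_le_3: "mu_max n \<mu> \<le> 3 * m" if "ln (real n) < real k"
  proof -
    have "real n powr (1 / real k) = exp (ln (real n) / real k)"
      using k by (simp add: powr_def)
    also have "\<dots> \<le> exp 1" using that k by simp
    also have "\<dots> \<le> 3" by (rule exp_le)
    finally have "real n powr (1 / real k) * m \<le> 3 * m" using m by (intro mult_right_mono)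
    with m show ?thesis by simp
  qed
  let ?b = "RLess (Cell ''t'' (IConst 0)) (Cell ''b'' (IConst 0))"
  define good where "good x \<longleftrightarrow> (ln (real n) < real k \<longrightarrow> mu_max n \<mu> \<le> scan_factor n k * x)" for x
  \<comment> \<open>The final disjunction records that either \<open>out\<close> is the current grid
    point, or some failed test has already made \<open>out\<close> good. A later certified point may
    still replace \<open>out\<close>, which restores the first alternative.\<close>
  define I where "I j s' \<longleftrightarrow> fst s' ''n'' = n \<and> fst s' ''k'' = k \<and>
    (\<forall>a\<le>k. snd s' ''p'' a = signed_power_sum n \<mu> a) \<and> snd s' ''d'' 0 = d \<and>
    snd s' ''b'' 0 = 3 * m \<and> snd s' ''t'' 0 = m + real j * d \<and>
    m \<le> snd s' ''out'' 0 \<and> snd s' ''out'' 0 \<le> mu_max n \<mu> \<and>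
    (snd s' ''out'' 0 = m + real j * d \<or> good (snd s' ''out'' 0))" for j s'
  have loop: "wp (While ?b scan_body) s1 (\<lambda>t s'.
      t \<le> 2 * k * k * (1 + bcost ?b + (k * (k * 40 + 60) + 40)) + (1 + bcost ?b) \<and>
      (m \<le> result s' \<and> result s' \<le> mu_max n \<mu> \<and> good (result s')))"
    if "I 0 s1" for s1
  proof (rule wp_While[where I = I])
    show "I 0 s1" by fact
  next
    fix j s' assume I: "I j s'" and b: "bval ?b s'"
    have lt: "m + real j * d < 3 * m" using I b by (simp add: I_def)
    \<comment> \<open>For \<open>m = 0\<close> the guard reads \<open>0 < 0\<close>, so inside the
      loop the spacing \<open>d\<close> is positive.\<close>
    have m_pos: "0 < m"
    proof (rule ccontr)
      assume "\<not> 0 < m"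
      then have "m = 0" "d = 0" using m by (auto simp: d_def)
      then show False using lt by simp
    qed
    then have d_pos: "0 < d" using k by (simp add: d_def)
    have m_eq: "m = real (k * k) * d" using k by (simp add: d_def)
    \<comment> \<open>The guard gives \<open>j * d < 2 * m\<close> and \<open>m = k * k * d\<close>,
      which bounds the number of rounds.\<close>
    have "real j * d < real (2 * k * k) * d" using lt m_eq by (simp add: mult_ac)
    then have jN: "j < 2 * k * k" using d_pos by (simp only: mult_less_cancel_right_pos of_nat_less_iff)
    define t where "t = m + real (Suc j) * d"
    have t_eq: "t = m + real j * d + m / (real k * real k)" by (simp add: t_def d_def algebra_simps add_divide_distrib)
    have t_pos: "m \<le> t" "0 < t" using m_pos d_pos by (auto simp: t_def intro: add_pos_nonneg)
    define s2 where "s2 = (fst s', (snd s')(''t'' := (snd s' ''t'')(0 := t)))"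
    have s2: "fst s2 ''k'' = k" "1 \<le> k" "snd s2 ''t'' 0 = t"
        "\<And>a. a \<le> k \<Longrightarrow> snd s2 ''p'' a = signed_power_sum n \<mu> a"
      using I k by (auto simp: I_def s2_def)
    let ?S = "\<Sum>i=1..n. cheb k (\<mu> i / t)"
    have cert: "t \<le> mu_max n \<mu>" if "real n < ?S"
      using less_mu_max_if_cheb_sum[OF t_pos(2) _ nn that] k by simp
    have uncert: "good (m + real j * d)" if "?S \<le> real n"
      unfolding good_def using that m_pos d_pos k nn
      by (intro impI mu_max_le_scan_factor[of m]) (auto simp flip: t_eq)
    have "wp scan_body s' (\<lambda>t s'. t \<le> k * (k * 40 + 60) + 40 \<and> I (Suc j) s')"
    proof -
      let ?if = "IfC (RLess (OfNat (IVar ''n'')) (Cell ''A'' (IConst 0)))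
        (RAssign ''out'' (IConst 0) (Cell ''t'' (IConst 0))) SKIP"
      have "wp cheb_prog s2 (\<lambda>u s''. wp ?if s'' (\<lambda>u' s''. u + u' \<le> k * (k * 40 + 60) + 30 \<and> I (Suc j) s''))"
      proof (rule wp_mono[OF cheb_prog_correct[where n = n and \<mu> = \<mu>, OF s2]], assumption, elim conjE)
        fix u s'' assume u: "u \<le> k * (k * 40 + 60) + 12"
          and un: "unchanged {''a'', ''j''} {''A'', ''B'', ''c''} s2 s''" and A: "snd s'' ''A'' 0 = ?S"
        have s'': "fst s'' ''n'' = n" "fst s'' ''k'' = k" "snd s'' ''t'' 0 = t" "snd s'' ''d'' 0 = d"
          "snd s'' ''b'' 0 = 3 * m" "\<forall>a\<le>k. snd s'' ''p'' a = signed_power_sum n \<mu> a"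
          "snd s'' ''out'' = snd s' ''out''"
          using un I by (auto simp: unchanged_def s2_def I_def)
        show "wp ?if s'' (\<lambda>u' s''. u + u' \<le> k * (k * 40 + 60) + 30 \<and> I (Suc j) s'')"
        proof (cases "real n < ?S")
          case True
          then have "I (Suc j) (fst s'', (snd s'')(''out'' := (snd s'' ''out'')(0 := t)))"
            using s'' cert t_pos by (simp add: I_def t_def)
          then show ?thesis using True u s'' A by (simp add: wp_simps)
        next
          case False
          then have "good (snd s'' ''out'' 0)" using uncert I s''(7) by (auto simp: I_def)
          then have "I (Suc j) s''"
            using s'' I by (simp add: I_def t_def)
          then show ?thesis using False u s'' A by (simp add: wp_simps)
        qed
      qed
      moreover have "snd s' ''t'' 0 + snd s' ''d'' 0 = t" using I by (simp add: I_def t_def algebra_simps)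
      ultimately show ?thesis
        unfolding scan_body_def wp_Seq wp_RAssign by (auto simp: s2_def elim!: wp_mono)
    qed
    with jN show "j < 2 * k * k \<and> wp scan_body s' (\<lambda>t s'. t \<le> k * (k * 40 + 60) + 40 \<and> I (Suc j) s')"
      by simp
  next
    fix j s' assume I: "I j s'" and b: "\<not> bval ?b s'"
    \<comment> \<open>If the last point tested was certified, no failed test follows it; instead the
      exit condition \<open>t \<ge> 3 * m\<close> already places \<open>out\<close> above the
      maximum.\<close>
    have "good (snd s' ''out'' 0)" if out: "snd s' ''out'' 0 = m + real j * d"
      unfolding good_def
    proof
      assume "ln (real n) < real k"
      then have "mu_max n \<mu> \<le> snd s' ''out'' 0"
        using mu_max_le_3 b I out by (auto simp: I_def)
      also have "\<dots> \<le> scan_factor n k * snd s' ''out'' 0"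
        using scan_factor_ge_1[of n k] m I by (auto simp: I_def intro!: mult_le_cancel_right1[THEN iffD2])
      finally show "mu_max n \<mu> \<le> scan_factor n k * snd s' ''out'' 0" .
    qed
    then show "m \<le> result s' \<and> result s' \<le> mu_max n \<mu> \<and> good (result s')"
      using I by (auto simp: I_def result_def)
  qed
  define s1 where "s1 = (fst s, (snd s)(''out'' := (snd s ''out'')(0 := m),
    ''d'' := (snd s ''d'')(0 := d), ''b'' := (snd s ''b'')(0 := 3 * m), ''t'' := (snd s ''t'')(0 := m)))"
  have "I 0 s1" using n k p m by (simp add: I_def s1_def)
  from loop[OF this] have "wp (While ?b scan_body) s1 (\<lambda>t s'.
      t \<le> 2 * k * k * (k * (k * 40 + 60) + 60) + 20 \<and>
      m \<le> result s' \<and> result s' \<le> mu_max n \<mu> \<and> good (result s'))"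
    by (rule wp_mono) (auto simp: algebra_simps)
  moreover have "0 - snd s ''p'' k / snd s ''p'' (k - 1) = m"
    by (simp add: m_def ratio_estimate_def p)
  ultimately show ?thesis
    unfolding scan_prog_def wp_Seq wp_RAssign
    by (auto simp: s1_def k d_def good_def m_def elim!: wp_mono)
qed

section \<open>Running time and approximation ratio of the combined program\<close>

theorem theorem3p1:
  "\<exists>C::real. C > 0 \<and>
    (\<exists>(prog :: com) (q :: nat poly).
      \<forall>(n::nat) (k::nat) (\<mu> :: nat \<Rightarrow> real).
        1 \<le> k \<longrightarrow> k < n \<longrightarrow> (\<forall>i\<in>{1..n}. 0 \<le> \<mu> i) \<longrightarrow>
        (\<exists>(t::nat) s.
          exec prog (input_state n k (esym n \<mu>)) t s \<and>
          t \<le> poly q k \<and>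
          result s \<le> mu_max n \<mu> \<and>
          mu_max n \<mu> \<le> alpha C k n * result s))"
proof (intro exI[of _ "614 :: real"] conjI exI[of _ "Seq newton_prog scan_prog"]
    exI[of _ "[:80, 30, 20:] + [:0, 0, 2:] * [:60, 60, 40:]"] allI impI)
  fix n k :: nat and \<mu> :: "nat \<Rightarrow> real"
  assume k: "1 \<le> k" "k < n" and "\<forall>i\<in>{1..n}. 0 \<le> \<mu> i"
  then have nn: "\<And>i. i \<in> {1..n} \<Longrightarrow> 0 \<le> \<mu> i" by blast
  let ?s = "input_state n k (esym n \<mu>)"
  \<comment> \<open>The first summand collects the Newton phase and the additive constants
    \<open>20 + 60\<close>; the product is \<open>2 * k\<^sup>2\<close> scan rounds, each of cost
    quadratic in \<open>k\<close>.\<close>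
  let ?q = "[:80, 30, 20:] + [:0, 0, 2:] * [:60, 60, 40:] :: nat poly"
  have "wp (Seq newton_prog scan_prog) ?s (\<lambda>t s'.
    t \<le> (k * (k * 20 + 30) + 20) + (2 * k * k * (k * (k * 40 + 60) + 60) + 60) \<and>
    (ratio_estimate n k \<mu> \<le> result s' \<and> result s' \<le> mu_max n \<mu> \<and>
    (ln (real n) < real k \<longrightarrow> mu_max n \<mu> \<le> scan_factor n k * result s')))"
    unfolding wp_Seq
  proof (rule wp_mono[OF newton_prog_correct[of ?s n k \<mu>]], goal_cases)
    case (4 t s')
    then have "fst s' ''n'' = n" "fst s' ''k'' = k"
      "\<And>a. a \<le> k \<Longrightarrow> snd s' ''p'' a = signed_power_sum n \<mu> a"
      by (auto simp: unchanged_def input_state_def)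
    from scan_prog_correct[OF this(1,2) k this(3) nn] show ?case
      by (rule wp_mono) (use 4 in auto)
  qed (auto simp: input_state_def)
  then obtain t s' where ex: "exec (Seq newton_prog scan_prog) ?s t s'"
    and t: "t \<le> (k * (k * 20 + 30) + 20) + (2 * k * k * (k * (k * 40 + 60) + 60) + 60)"
    and res: "ratio_estimate n k \<mu> \<le> result s'" "result s' \<le> mu_max n \<mu>"
      "ln (real n) < real k \<Longrightarrow> mu_max n \<mu> \<le> scan_factor n k * result s'"
    unfolding wp_def by blast
  have "t \<le> poly ?q k" using t by (simp add: algebra_simps)
  moreover have "mu_max n \<mu> \<le> alpha 614 k n * result s'"
  \<comment> \<open>For small \<open>k\<close> it suffices that the output is at least the quotient
    estimate; only for large \<open>k\<close> is the scan guarantee used.\<close>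
  proof (cases "real k \<le> ln (real n)")
    case True
    have "mu_max n \<mu> \<le> real n powr (1 / real k) * ratio_estimate n k \<mu>"
      using k nn by (intro mu_max_le_ratio_estimate) auto
    also have "\<dots> \<le> real n powr (1 / real k) * result s'"
      using res(1) by (intro mult_left_mono) auto
    finally show ?thesis using True by (simp add: alpha_def)
  next
    case False
    then have "mu_max n \<mu> \<le> scan_factor n k * result s'" using res(3) by simp
    also have "\<dots> \<le> (1 + 614 * (ln (real n) / real k)\<^sup>2) * result s'"
      using False k order.trans[OF ratio_estimate_nonneg[of k n \<mu>, OF k(1) nn] res(1)]
      by (intro mult_right_mono scan_factor_le) auto
    finally show ?thesis using False by (simp add: alpha_def)
  qed
  ultimately show "\<exists>t s. exec (Seq newton_prog scan_prog) ?s t s \<and> t \<le> poly ?q k \<and>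
      result s \<le> mu_max n \<mu> \<and> mu_max n \<mu> \<le> alpha 614 k n * result s"
    using ex res(2) by blast
qed simp

end
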